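(* Let $n\ge 0$ be an integer and let $q,a,b$ be nonzero complex parameters such that no denominator occurring below vanishes. Then $$ {}_4\phi_3\left[\begin{array}{c} q^{-2n},\, a,\, b,\, q^{3-2n}/ab \\ q^{2-2n}/a,\, q^{2-2n}/b,\, abq\end{array};q^2,\,q^2\right] =\frac{(a,b,-q;q)_n\,(ab;q^2)_n}{(1-abq^{2n-1})\,(ab;q)_{n-1}\,(a,b;q^2)_n}. $$
   Context: For an integer $n\ge 0$, $(x;q)_n=\prod_{i=0}^{n-1}(1-xq^i)$ (so $(x;q)_0=1$), and $(x_1,\ldots,x_m;q)_n=\prod_{i=1}^m (x_i;q)_n$; $(x;q^2)_n$ is the same with $q$ replaced by $q^2$. For index $-1$ (occurring only when $n=0$) the usual convention is $(x;q)_{-1}=1/(1-xq^{-1})$. The basic hypergeometric series is $${}_4\phi_3\left[\begin{array}{c} a_1,a_2,a_3,a_4\\ b_1,b_2,b_3\end{array};q,z\right]=\sum_{k\ge 0}\frac{(a_1,a_2,a_3,a_4;q)_k\,z^k}{(q,b_1,b_2,b_3;q)_k}.$$ In the claim the base is $q^2$ (replace $q$ by $q^2$ in the definition) and $a_1=q^{-2n}$, so the series terminates: it denotes the finite sum over $0\le k\le n$. Here $q^{c}/ab$ means $q^{c}/(ab)$. The identity is to be understood as an identity of rational functions in $a,b,q$, i.e. valid whenever no denominator vanishes. *)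

theory Defs
  imports Complex_Main
begin

definition qpoch :: "complex \<Rightarrow> complex \<Rightarrow> nat \<Rightarrow> complex" where
  "qpoch x q n = (\<Prod>i<n. 1 - x * q ^ i)"

text \<open>
  The usual extension to integer indices,
  $(x;q)_{-m} = 1 / \prod_{i=1}^{m} (1 - x q^{-i})$; only the index $-1$ will matter.
\<close>

definition qpoch_int :: "complex \<Rightarrow> complex \<Rightarrow> int \<Rightarrow> complex" where
  "qpoch_int x q k =
     (if k \<ge> 0 then qpoch x q (nat k)
      else 1 / (\<Prod>i = 1..nat (- k). 1 - x * q powi (- int i)))"

lemma qpoch_int_of_nat: "qpoch_int x q (int n) = qpoch x q n"
  by (simp add: qpoch_int_def)

lemma qpoch_int_minus_1: "qpoch_int x q (-1) = 1 / (1 - x * q powi (-1))"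
  by (simp add: qpoch_int_def)

text \<open>$(x_1, \ldots, x_m; q)_n$, with the $x_i$ given as a list\<close>

definition qpochs :: "complex list \<Rightarrow> complex \<Rightarrow> nat \<Rightarrow> complex" where
  "qpochs xs q n = (\<Prod>x\<leftarrow>xs. qpoch x q n)"

definition phi43 ::
  "complex \<Rightarrow> complex \<Rightarrow> complex \<Rightarrow> complex \<Rightarrow> complex \<Rightarrow> complex \<Rightarrow> complex
     \<Rightarrow> complex \<Rightarrow> complex \<Rightarrow> complex" where
  "phi43 a\<^sub>1 a\<^sub>2 a\<^sub>3 a\<^sub>4 b\<^sub>1 b\<^sub>2 b\<^sub>3 q z =
     (\<Sum>k. qpochs [a\<^sub>1, a\<^sub>2, a\<^sub>3, a\<^sub>4] q k * z ^ k / qpochs [q, b\<^sub>1, b\<^sub>2, b\<^sub>3] q k)"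

text \<open>
  If $a_1 = q^{-n}$, all numerators with $k > n$ vanish, so those terms are $0$ (also where a
  denominator vanishes, as $0 / 0 = 0$), and the series is the finite sum over
  $0 \le k \le n$.
\<close>

lemma phi43_terminating:
  assumes "a\<^sub>1 * q ^ n = 1"
  shows "phi43 a\<^sub>1 a\<^sub>2 a\<^sub>3 a\<^sub>4 b\<^sub>1 b\<^sub>2 b\<^sub>3 q z =
     (\<Sum>k\<le>n. qpochs [a\<^sub>1, a\<^sub>2, a\<^sub>3, a\<^sub>4] q k * z ^ k / qpochs [q, b\<^sub>1, b\<^sub>2, b\<^sub>3] q k)"
  unfolding phi43_def
proof (rule suminf_finite)
  fix k assume "k \<notin> {..n}"
  then have "qpoch a\<^sub>1 q k = 0"
    using assms unfolding qpoch_def by (intro prod_zero) auto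
  then show "qpochs [a\<^sub>1, a\<^sub>2, a\<^sub>3, a\<^sub>4] q k * z ^ k / qpochs [q, b\<^sub>1, b\<^sub>2, b\<^sub>3] q k = 0"
    by (simp add: qpochs_def)
qed simp

end

theory Submission
  imports Defs
begin

text \<open>
  Put $c = ab/q$ and let $A_k = (a,b;q^2)_k / (q^2,abq;q^2)_k$ be the coefficients of
  ${}_2\phi_1(a,b;abq;q^2,x)$. Reversing the four shifted factorials whose parameters contain
  $q^{-2n}$ (\<open>qpoch_reverse\<close>) turns the terminating series into a constant multiple of
  $\sum_k A_k A_{n-k}\, q^k (1 - c q^{2(n-k)})$ (\<open>phi43_term\<close>). So the claim is a
  Clausen-type formula for the product of two ${}_2\phi_1$ series, read off coefficientwise.

  Let $M_n(i,j) = \sum_k A_k A_{n-k}\, q^{ki} q^{(n-k)j}$. These moments are symmetric in $i$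
  and $j$, and $M_n(i+1,j+1) = q^n M_n(i,j)$ because $q^k q^{n-k} = q^n$. In particular the sum
  above is $M_n(1,0) - c M_n(1,2) = (1 - c q^n) M_n(1,0)$, and only $M_n(1,0)$ has to be found.
  The two-term recurrence of $A_k$, inserted in the first factor of the convolution, expresses
  a combination of $M_n(0,j), M_n(2,j), M_n(4,j)$ by the same moments for $n-1$. For $j = 1$ and
  $j = 3$ all of these are multiples of just two quantities, $M_n(1,0)$ and $M_n(0,3)$. The
  second one enters the two relations with proportional coefficients, and with the same ratio
  $c q^n = ab q^{n-1}$ on both sides, so it can be eliminated; what remains factors completely
  into a first-order recurrence for $M_n(1,0)$ (\<open>moment_recurrence\<close>), which gives its product
  formula (\<open>moment_phi21\<close>).
\<close>

section \<open>Shifted factorials\<close>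

lemma qpoch_0 [simp]: "qpoch x p 0 = 1"
  by (simp add: qpoch_def)

lemma qpoch_Suc: "qpoch x p (Suc n) = qpoch x p n * (1 - x * p ^ n)"
  by (simp add: qpoch_def)

lemma qpoch_Suc_left: "qpoch x p (Suc n) = (1 - x) * qpoch (x * p) p n"
  by (induction n) (simp_all add: qpoch_Suc mult.assoc)

lemma qpoch_add: "qpoch x p (m + k) = qpoch x p m * qpoch (x * p ^ m) p k"
  by (induction k) (simp_all add: qpoch_Suc power_add mult.assoc)

lemma qpoch_nonzero_mono: "qpoch x p n \<noteq> 0 \<Longrightarrow> k \<le> n \<Longrightarrow> qpoch x p k \<noteq> 0"
  by (metis le_add_diff_inverse mult_eq_0_iff qpoch_add)

lemma qpoch_square: "qpoch (x\<^sup>2) (q\<^sup>2) n = qpoch x q n * qpoch (- x) q n"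
proof (induction n)
  case (Suc n)
  have "1 - x\<^sup>2 * (q\<^sup>2) ^ n = (1 - x * q ^ n) * (1 - - x * q ^ n)"
    by (simp add: power2_eq_square power_mult_distrib algebra_simps)
  then show ?case by (simp add: qpoch_Suc Suc.IH)
qed simp

text \<open>
  The product on the left does not depend on \<open>d\<close>. It therefore cancels when this
  lemma is applied to as many numerator as denominator parameters.
\<close>

lemma qpoch_reverse:
  assumes "p \<noteq> 0" and "d \<noteq> 0" and "k \<le> n"
  shows "qpoch (p powi (1 - int n) / d) p k * ((- d) ^ k * (\<Prod>i<k. p ^ (n - Suc i)))
           = qpoch (d * p ^ (n - k)) p k"
proof -
  have "(1 - p powi (1 - int n) / d * p ^ i) * (- d * p ^ (n - Suc i)) = 1 - d * p ^ (n - Suc i)"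
    if "i < k" for i
  proof -
    have "int (n - Suc i) = int n - 1 - int i" using that assms by linarith
    then have e: "p ^ (n - Suc i) = p powi (int n - 1 - int i)"
      by (metis power_int_of_nat)
    have "p powi (1 - int n) * p ^ i * p ^ (n - Suc i)
            = p powi ((1 - int n) + int i + (int n - 1 - int i))"
      unfolding e using assms by (simp only: power_int_add power_int_of_nat simp_thms)
    then have "p powi (1 - int n) * p ^ i * p ^ (n - Suc i) = 1" by simp
    then show ?thesis using assms(2) by (simp add: field_simps)
  qed
  moreover have "(- d) ^ k * (\<Prod>i<k. p ^ (n - Suc i)) = (\<Prod>i<k. - d * p ^ (n - Suc i))"
    by (simp only: prod.distrib prod_constant card_lessThan)
  ultimately have "qpoch (p powi (1 - int n) / d) p k * ((- d) ^ k * (\<Prod>i<k. p ^ (n - Suc i)))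
      = (\<Prod>i<k. 1 - d * p ^ (n - Suc i))"
    unfolding qpoch_def
    by (simp only: prod.distrib [symmetric]) (intro prod.cong refl, simp only: lessThan_iff)
  also have "\<dots> = (\<Prod>i<k. 1 - d * p ^ (n - Suc (k - Suc i)))"
    by (rule prod.nat_diff_reindex [symmetric])
  also have "\<dots> = qpoch (d * p ^ (n - k)) p k"
    unfolding qpoch_def
  proof (rule prod.cong [OF refl])
    fix i assume "i \<in> {..<k}"
    then have "n - Suc (k - Suc i) = (n - k) + i" using assms(3) by auto
    then show "1 - d * p ^ (n - Suc (k - Suc i)) = 1 - d * p ^ (n - k) * p ^ i"
      by (simp add: power_add mult.assoc)
  qed
  finally show ?thesis .
qed

section \<open>Weighted self-convolutions\<close>

definition moment :: "(nat \<Rightarrow> complex) \<Rightarrow> complex \<Rightarrow> nat \<Rightarrow> nat \<Rightarrow> nat \<Rightarrow> complex" where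
  "moment A q i j n = (\<Sum>k\<le>n. A k * A (n - k) * (q ^ k) ^ i * (q ^ (n - k)) ^ j)"

lemma moment_commute: "moment A q i j n = moment A q j i n"
  unfolding moment_def
  by (subst sum.nat_diff_reindex [where n = "Suc n", symmetric, simplified lessThan_Suc_atMost])
     (intro sum.cong refl, simp add: mult_ac)

lemma moment_Suc_Suc: "moment A q (Suc i) (Suc j) n = q ^ n * moment A q i j n"
proof -
  have "A k * A (n - k) * (q ^ k) ^ Suc i * (q ^ (n - k)) ^ Suc j
          = q ^ n * (A k * A (n - k) * (q ^ k) ^ i * (q ^ (n - k)) ^ j)" if "k \<le> n" for k
  proof -
    have "q ^ n = q ^ k * q ^ (n - k)" using that by (simp flip: power_add)
    then show ?thesis by (simp add: mult_ac)
  qed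
  then show ?thesis unfolding moment_def sum_distrib_left by (intro sum.cong refl) simp
qed

text \<open>
  The recurrence is summed against \<open>A (m - k)\<close>. Its left-hand side, taken at \<open>k\<close> in place
  of \<open>Suc k\<close>, vanishes for \<open>k = 0\<close>, so the shift of the index loses no boundary term.
\<close>

lemma moment_step:
  assumes rec: "\<And>k. k \<le> m \<Longrightarrow>
     (1 - (q ^ Suc k)\<^sup>2) * (1 - c * (q ^ Suc k)\<^sup>2) * A (Suc k)
       = (1 - a * (q ^ k)\<^sup>2) * (1 - b * (q ^ k)\<^sup>2) * A k"
  shows "moment A q 0 j (Suc m) - (1 + c) * moment A q 2 j (Suc m) + c * moment A q 4 j (Suc m)
         = moment A q 0 j m - (a + b) * moment A q 2 j m + a * b * moment A q 4 j m"
proof -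
  have quad: "moment A q 0 j n - (s + t) * moment A q 2 j n + s * t * moment A q 4 j n
      = (\<Sum>k\<le>n. (1 - s * (q ^ k)\<^sup>2) * (1 - t * (q ^ k)\<^sup>2) * A k * A (n - k) * (q ^ (n - k)) ^ j)"
    for s t n
    unfolding moment_def sum_distrib_left sum_subtractf [symmetric] sum.distrib [symmetric]
    by (intro sum.cong refl) algebra
  have "moment A q 0 j (Suc m) - (1 + c) * moment A q 2 j (Suc m) + c * moment A q 4 j (Suc m)
      = (\<Sum>k\<le>m. (1 - (q ^ Suc k)\<^sup>2) * (1 - c * (q ^ Suc k)\<^sup>2) * A (Suc k)
                  * A (m - k) * (q ^ (m - k)) ^ j)"
    using quad [where s = 1 and t = c and n = "Suc m"]
    by (simp add: sum.atMost_Suc_shift del: sum.atMost_Suc power_Suc)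
  also have "\<dots> = (\<Sum>k\<le>m. (1 - a * (q ^ k)\<^sup>2) * (1 - b * (q ^ k)\<^sup>2) * A k
                  * A (m - k) * (q ^ (m - k)) ^ j)"
    by (intro sum.cong refl) (simp only: rec atMost_iff)
  finally show ?thesis by (simp only: quad)
qed

text \<open>
  Since \<open>moment A q 0 3\<close> occurs with coefficients in the ratio \<open>c * q ^ Suc m\<close> in the two
  instances of \<open>moment_step\<close> at level \<open>Suc m\<close>, and in the ratio \<open>a * b * q ^ m\<close> at level
  \<open>m\<close>, the assumption \<open>c * q = a * b\<close> is exactly what lets one subtraction remove it
  from both sides.
\<close>

lemma moment_recurrence:
  assumes rec: "\<And>k. k \<le> m \<Longrightarrow>
     (1 - (q ^ Suc k)\<^sup>2) * (1 - c * (q ^ Suc k)\<^sup>2) * A (Suc k)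
       = (1 - a * (q ^ k)\<^sup>2) * (1 - b * (q ^ k)\<^sup>2) * A k"
    and c: "c * q = a * b"
  shows "(1 - q ^ Suc m) * (1 - c * q ^ Suc m) * (1 - c * (q ^ Suc m)\<^sup>2) * moment A q 1 0 (Suc m)
         = (1 - a * q ^ m) * (1 - b * q ^ m) * (1 - a * b * (q ^ m)\<^sup>2) * moment A q 1 0 m"
proof -
  have weights:
    "moment A q 0 1 n = moment A q 1 0 n"
    "moment A q 2 1 n = q ^ n * moment A q 1 0 n"
    "moment A q 4 1 n = q ^ n * moment A q 0 3 n"
    "moment A q 2 3 n = (q ^ n)\<^sup>2 * moment A q 1 0 n"
    "moment A q 4 3 n = (q ^ n) ^ 3 * moment A q 1 0 n" for n
    using moment_commute [of A q 0 1 n] moment_commute [of A q 3 0 n]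
    by (simp_all add: numeral_eq_Suc moment_Suc_Suc)
  have j1: "moment A q 1 0 (Suc m) - (1 + c) * (q ^ Suc m * moment A q 1 0 (Suc m))
             + c * (q ^ Suc m * moment A q 0 3 (Suc m))
      = moment A q 1 0 m - (a + b) * (q ^ m * moment A q 1 0 m) + a * b * (q ^ m * moment A q 0 3 m)"
    using moment_step [of m q c A a b 1, OF rec] by (simp only: weights)
  have j3: "moment A q 0 3 (Suc m) - (1 + c) * ((q ^ Suc m)\<^sup>2 * moment A q 1 0 (Suc m))
             + c * ((q ^ Suc m) ^ 3 * moment A q 1 0 (Suc m))
      = moment A q 0 3 m - (a + b) * ((q ^ m)\<^sup>2 * moment A q 1 0 m)
             + a * b * ((q ^ m) ^ 3 * moment A q 1 0 m)"
    using moment_step [of m q c A a b 3, OF rec] by (simp only: weights)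
  have shift: "c * q ^ Suc m = a * b * q ^ m" using c by (simp add: mult.assoc [symmetric])
  have eliminate: "x - (s + t) * (z * x) + w * (z * v)
        - w * z * (v - (s + t) * (z\<^sup>2 * x) + w * (z ^ 3 * x))
      = (1 - (s + t) * z + w * z * ((s + t) * z\<^sup>2) - w * z * (w * z ^ 3)) * x"
    for x v z w s t :: complex
    by (simp add: algebra_simps)
  have factor: "1 - (s + t) * z + s * t * z * ((s + t) * z\<^sup>2) - s * t * z * (s * t * z ^ 3)
      = (1 - s * z) * (1 - t * z) * (1 - s * t * z\<^sup>2)" for s t z :: complex
    by (simp add: algebra_simps power2_eq_square power3_eq_cube)
  have "(1 - q ^ Suc m) * (1 - c * q ^ Suc m) * (1 - c * (q ^ Suc m)\<^sup>2) * moment A q 1 0 (Suc m)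
      = moment A q 1 0 (Suc m) - (1 + c) * (q ^ Suc m * moment A q 1 0 (Suc m))
             + c * (q ^ Suc m * moment A q 0 3 (Suc m))
        - c * q ^ Suc m * (moment A q 0 3 (Suc m)
             - (1 + c) * ((q ^ Suc m)\<^sup>2 * moment A q 1 0 (Suc m))
             + c * ((q ^ Suc m) ^ 3 * moment A q 1 0 (Suc m)))"
    using factor [of 1 c "q ^ Suc m"] by (simp only: eliminate mult_1)
  also have "\<dots> = (1 - a * q ^ m) * (1 - b * q ^ m) * (1 - a * b * (q ^ m)\<^sup>2) * moment A q 1 0 m"
    unfolding j1 j3 shift eliminate factor ..
  finally show ?thesis .
qed

section \<open>The coefficients of the series and the product formula\<close>

definition phi21_coeff :: "complex \<Rightarrow> complex \<Rightarrow> complex \<Rightarrow> complex \<Rightarrow> nat \<Rightarrow> complex" where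
  "phi21_coeff a b e p k = qpoch a p k * qpoch b p k / (qpoch p p k * qpoch e p k)"

lemma phi21_coeff_Suc:
  assumes "qpoch p p (Suc k) \<noteq> 0" and "qpoch e p (Suc k) \<noteq> 0"
  shows "(1 - p ^ Suc k) * (1 - e * p ^ k) * phi21_coeff a b e p (Suc k)
           = (1 - a * p ^ k) * (1 - b * p ^ k) * phi21_coeff a b e p k"
  using assms by (simp add: phi21_coeff_def qpoch_Suc divide_simps)

text \<open>
  The factors on the left are not divided out, because \<open>qpoch (a * b) q n\<close> may vanish through
  its last factor \<open>1 - a * b * q ^ (n - 1)\<close> under the hypotheses of the summation formula.
\<close>

lemma moment_phi21:
  assumes "qpoch (q\<^sup>2) (q\<^sup>2) n \<noteq> 0" and "qpoch (a * b * q) (q\<^sup>2) n \<noteq> 0" and "c * q = a * b"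
  shows "qpoch q q n * qpoch (a * b) q n * qpoch (a * b * q) (q\<^sup>2) n
           * moment (phi21_coeff a b (a * b * q) (q\<^sup>2)) q 1 0 n
         = qpoch a q n * qpoch b q n * qpoch (a * b) (q\<^sup>2) n"
  using assms(1,2)
proof (induction n)
  case 0
  then show ?case by (simp add: moment_def phi21_coeff_def)
next
  case (Suc m)
  let ?A = "phi21_coeff a b (a * b * q) (q\<^sup>2)"
  have IH: "qpoch q q m * qpoch (a * b) q m * qpoch (a * b * q) (q\<^sup>2) m * moment ?A q 1 0 m
         = qpoch a q m * qpoch b q m * qpoch (a * b) (q\<^sup>2) m"
    using Suc.prems by (intro Suc.IH) (auto simp: qpoch_Suc)
  have "(1 - (q ^ Suc k)\<^sup>2) * (1 - c * (q ^ Suc k)\<^sup>2) * ?A (Suc k)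
       = (1 - a * (q ^ k)\<^sup>2) * (1 - b * (q ^ k)\<^sup>2) * ?A k" if "k \<le> m" for k
  proof -
    have "(q\<^sup>2) ^ j = (q ^ j)\<^sup>2" for j by (simp add: mult.commute flip: power_mult)
    moreover have "c * (q ^ Suc k)\<^sup>2 = a * b * q * (q ^ k)\<^sup>2"
      using assms(3) by (simp add: power2_eq_square mult_ac)
    ultimately show ?thesis
      using phi21_coeff_Suc [of "q\<^sup>2" k "a * b * q" a b] Suc.prems that
        qpoch_nonzero_mono [of _ _ "Suc m" "Suc k"] by (metis Suc_le_mono)
  qed
  note main = moment_recurrence [OF this assms(3)]
  have rec: "(1 - q * q ^ m) * (1 - a * b * q ^ m) * (1 - a * b * q * (q\<^sup>2) ^ m)
        * moment ?A q 1 0 (Suc m)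
      = (1 - a * q ^ m) * (1 - b * q ^ m) * (1 - a * b * (q\<^sup>2) ^ m) * moment ?A q 1 0 m"
  proof -
    have sq: "(q\<^sup>2) ^ m = (q ^ m)\<^sup>2" by (simp add: mult.commute flip: power_mult)
    have cq: "c * q ^ Suc m = a * b * q ^ m" "c * (q ^ Suc m)\<^sup>2 = a * b * q * (q ^ m)\<^sup>2"
      unfolding assms(3) [symmetric] by (simp_all add: power2_eq_square mult_ac)
    show ?thesis using main [of m] unfolding cq sq by simp
  qed
  have chain: "u * x * (v * y) * (w * z) * t' = u' * x' * (v' * y') * (w' * z')"
    if "u * v * w * t = u' * v' * w'" and "x * y * z * t' = x' * y' * z' * t"
    for u v w x y z t t' u' v' w' x' y' z' :: complex
  proof -
    have "u * x * (v * y) * (w * z) * t' = u * v * w * (x * y * z * t')" by (simp add: mult_ac)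
    also have "\<dots> = u * v * w * t * (x' * y' * z')" unfolding that(2) by (simp add: mult_ac)
    finally show ?thesis unfolding that(1) by (simp add: mult_ac)
  qed
  show ?case unfolding qpoch_Suc by (rule chain [OF IH rec])
qed

section \<open>The summation formula\<close>

text \<open>
  All four of the parameters $q^{-2n}, q^{3-2n}/ab, q^{2-2n}/a, q^{2-2n}/b$ have the form
  $p^{1-n}/d$ with $p = q^2$, for $d = p, c, a, b$ respectively, and so are reversed by
  \<open>qpoch_reverse\<close>. The powers of $d$ combine to $(ab/pc)^k = (q/p)^k$, which turns the argument
  $p^k$ into $q^k$. The reversal at $d = c$ produces $(c;p)_n / (c;p)_{n-k}$; this is rewritten
  through $(cp;p)_n / (cp;p)_{n-k}$, with $cp = abq$, in order to obtain the same coefficients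
  $A_{n-k}$ as for the first factor, and to include the case $c = 1$, where
  $(c;p)_{n-k}$ vanishes.
\<close>

lemma phi43_term:
  assumes "q \<noteq> 0" "a \<noteq> 0" "b \<noteq> 0" "k \<le> n"
    and c: "c * q = a * b"
    and nz: "qpoch (q\<^sup>2) (q\<^sup>2) n \<noteq> 0" "qpoch (a * b * q) (q\<^sup>2) n \<noteq> 0"
      "qpoch a (q\<^sup>2) n \<noteq> 0" "qpoch b (q\<^sup>2) n \<noteq> 0"
      "1 - c * (q\<^sup>2) ^ n \<noteq> 0"
  shows "qpochs [q powi (- 2 * int n), a, b, q powi (3 - 2 * int n) / (a * b)] (q\<^sup>2) k * (q\<^sup>2) ^ k
      / qpochs [q\<^sup>2, q powi (2 - 2 * int n) / a, q powi (2 - 2 * int n) / b, a * b * q] (q\<^sup>2) k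
    = qpoch (q\<^sup>2) (q\<^sup>2) n * qpoch (a * b * q) (q\<^sup>2) n
        / ((1 - c * (q\<^sup>2) ^ n) * qpoch a (q\<^sup>2) n * qpoch b (q\<^sup>2) n)
      * (phi21_coeff a b (a * b * q) (q\<^sup>2) k * phi21_coeff a b (a * b * q) (q\<^sup>2) (n - k) * q ^ k
          * (1 - c * (q\<^sup>2) ^ (n - k)))"
proof -
  define p where "p = q\<^sup>2"
  define w where "w = (\<Prod>i<k. p ^ (n - Suc i))"
  define r where "r d = qpoch (p powi (1 - int n) / d) p k" for d
  have p0: "p \<noteq> 0" and c0: "c \<noteq> 0" and w0: "w \<noteq> 0"
    using assms by (auto simp: p_def w_def)
  have ppow: "p powi j = q powi (2 * j)" for j
    by (simp add: p_def power_int_mult)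
  have params: "q powi (- 2 * int n) = p powi (1 - int n) / p"
    "q powi (2 - 2 * int n) = p powi (1 - int n)"
    "q powi (3 - 2 * int n) / (a * b) = p powi (1 - int n) / c"
  proof -
    show "q powi (2 - 2 * int n) = p powi (1 - int n)" by (simp add: ppow)
    have "p powi (1 - int n) = p * p powi (- int n)"
      using p0 power_int_add [of p 1 "- int n"] by simp
    then show "q powi (- 2 * int n) = p powi (1 - int n) / p" using p0 by (simp add: ppow)
    have "q powi (3 - 2 * int n) = q * q powi (2 - 2 * int n)"
      using assms(1) power_int_add [of q 1 "2 - 2 * int n"] by simp
    then show "q powi (3 - 2 * int n) / (a * b) = p powi (1 - int n) / c"
      using assms(1) c0 by (simp add: ppow flip: c)
  qed
  have rev: "r d * ((- d) ^ k * w) = qpoch (d * p ^ (n - k)) p k" if "d \<noteq> 0" for d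
    unfolding r_def w_def by (rule qpoch_reverse) (use p0 that assms(4) in auto)
  have split: "qpoch d p n = qpoch d p (n - k) * qpoch (d * p ^ (n - k)) p k" for d
    using qpoch_add [of d p "n - k" k] assms(4) by simp
  have ra: "r d * ((- d) ^ k * w) * qpoch d p (n - k) = qpoch d p n" if "d \<noteq> 0" for d
    using rev [OF that] split [of d] by simp
  have cp: "c * p = a * b * q" using c by (simp add: p_def power2_eq_square flip: mult.assoc)
  \<comment> \<open>Both sides of \<open>rc\<close> split one factor off \<open>qpoch (c * p ^ (n - k)) p (Suc k)\<close>, at opposite ends.\<close>
  have rc: "r c * ((- c) ^ k * w) * (1 - c * p ^ n) * qpoch (a * b * q) p (n - k)
              = (1 - c * p ^ (n - k)) * qpoch (a * b * q) p n"
  proof -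
    have "qpoch (c * p ^ (n - k)) p k * (1 - c * p ^ n) = qpoch (c * p ^ (n - k)) p (Suc k)"
      using assms(4) by (simp add: qpoch_Suc mult.assoc flip: power_add)
    also have "\<dots> = (1 - c * p ^ (n - k)) * qpoch (a * b * q * p ^ (n - k)) p k"
      unfolding qpoch_Suc_left cp [symmetric] by (simp add: mult_ac)
    finally show ?thesis using rev [OF c0] split [of "a * b * q"] by (simp add: mult_ac)
  qed
  have nz': "qpoch d p (n - k) \<noteq> 0" "qpoch d p k \<noteq> 0" if "qpoch d p n \<noteq> 0" for d
    using qpoch_nonzero_mono [OF that] assms(4) by auto
  note nz = nz [folded p_def]
  have r_eq: "r d = qpoch d p n / ((- d) ^ k * w * qpoch d p (n - k))"
    if "d \<noteq> 0" "qpoch d p n \<noteq> 0" for d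
    using ra [OF that(1)] that w0 nz' [OF that(2)] by (simp add: field_simps)
  have rc_eq: "r c = (1 - c * p ^ (n - k)) * qpoch (a * b * q) p n
      / ((- c) ^ k * w * (1 - c * p ^ n) * qpoch (a * b * q) p (n - k))"
    using rc c0 w0 nz nz' [OF nz(2)] by (simp add: field_simps)
  have powers: "(- a) ^ k * (- b) ^ k * p ^ k = (- p) ^ k * (- c) ^ k * q ^ k"
    by (simp add: power_mult_distrib [symmetric] c [symmetric] mult_ac)
  have "r p * qpoch a p k * qpoch b p k * r c * p ^ k / (qpoch p p k * r a * r b * qpoch (a * b * q) p k)
    = qpoch p p n * qpoch (a * b * q) p n / ((1 - c * p ^ n) * qpoch a p n * qpoch b p n)
      * (phi21_coeff a b (a * b * q) p k * phi21_coeff a b (a * b * q) p (n - k)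
          * ((- a) ^ k * (- b) ^ k * p ^ k / ((- p) ^ k * (- c) ^ k)) * (1 - c * p ^ (n - k)))"
    unfolding r_eq [OF p0 nz(1)] r_eq [OF assms(2) nz(3)] r_eq [OF assms(3) nz(4)] rc_eq
      phi21_coeff_def
    using nz nz' [OF nz(1)] nz' [OF nz(2)] nz' [OF nz(3)] nz' [OF nz(4)] w0 p0 c0 assms(2,3)
    by (simp add: divide_simps mult_ac)
  also have "(- a) ^ k * (- b) ^ k * p ^ k / ((- p) ^ k * (- c) ^ k) = q ^ k"
    unfolding powers using p0 c0 by simp
  finally show ?thesis
    unfolding p_def [symmetric] params qpochs_def r_def by (simp add: mult_ac)
qed

theorem mainTheorem4:
  fixes n :: nat and q a b :: complex
  assumes "q \<noteq> 0" and "a \<noteq> 0" and "b \<noteq> 0"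
    and "\<And>k. k \<le> n \<Longrightarrow>
      qpochs [q ^ 2, q powi (2 - 2 * int n) / a, q powi (2 - 2 * int n) / b, a * b * q] (q ^ 2) k \<noteq> 0"
    and "1 - a * b * q powi (2 * int n - 1) \<noteq> 0"
    and "qpoch_int (a * b) q (int n - 1) \<noteq> 0"
    and "qpochs [a, b] (q ^ 2) n \<noteq> 0"
  shows "phi43 (q powi (- 2 * int n)) a b (q powi (3 - 2 * int n) / (a * b))
               (q powi (2 - 2 * int n) / a) (q powi (2 - 2 * int n) / b) (a * b * q)
               (q ^ 2) (q ^ 2) =
         qpochs [a, b, - q] q n * qpoch (a * b) (q ^ 2) n /
         ((1 - a * b * q powi (2 * int n - 1)) * qpoch_int (a * b) q (int n - 1) *
          qpochs [a, b] (q ^ 2) n)"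
proof -
  define c where "c = a * b / q"
  have c: "c * q = a * b" using assms(1) by (simp add: c_def)
  let ?A = "phi21_coeff a b (a * b * q) (q\<^sup>2)"
  let ?D = "1 - c * (q\<^sup>2) ^ n"
  let ?I = "qpoch_int (a * b) q (int n - 1)"
  have D: "1 - a * b * q powi (2 * int n - 1) = ?D"
  proof -
    have "q powi (2 * int n - 1) = q powi (2 * int n) / q"
      using assms(1) by (simp add: power_int_diff)
    also have "q powi (2 * int n) = (q\<^sup>2) ^ n" by (simp add: power_int_mult)
    finally show ?thesis by (simp add: c_def)
  qed
  have nz: "qpoch (q\<^sup>2) (q\<^sup>2) n \<noteq> 0" "qpoch (a * b * q) (q\<^sup>2) n \<noteq> 0"
      "qpoch a (q\<^sup>2) n \<noteq> 0" "qpoch b (q\<^sup>2) n \<noteq> 0" "?D \<noteq> 0"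
    using assms(4) [of n] assms(5,7) by (auto simp: qpochs_def D)
  \<comment> \<open>For \<open>n = 0\<close> the left factor is \<open>1 / (1 - c)\<close>, and its being nonzero means \<open>c \<noteq> 1\<close>.\<close>
  have I: "?I * (1 - c * q ^ n) = qpoch (a * b) q n"
  proof (cases n)
    case 0
    then show ?thesis using assms(6) by (auto simp: qpoch_int_minus_1 c_def field_simps)
  next
    case (Suc m)
    then show ?thesis by (simp add: qpoch_int_of_nat qpoch_Suc flip: c)
  qed
  have term_one: "q powi (- 2 * int n) * (q\<^sup>2) ^ n = 1"
  proof -
    have "(q\<^sup>2) ^ n = q powi (2 * int n)" by (simp add: power_int_mult)
    then show ?thesis using assms(1) by (simp add: power_int_minus)
  qed
  let ?K = "qpoch (q\<^sup>2) (q\<^sup>2) n * qpoch (a * b * q) (q\<^sup>2) n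
        / (?D * qpoch a (q\<^sup>2) n * qpoch b (q\<^sup>2) n)"
  have "phi43 (q powi (- 2 * int n)) a b (q powi (3 - 2 * int n) / (a * b))
               (q powi (2 - 2 * int n) / a) (q powi (2 - 2 * int n) / b) (a * b * q) (q\<^sup>2) (q\<^sup>2)
      = ?K * (\<Sum>k\<le>n. ?A k * ?A (n - k) * q ^ k * (1 - c * (q\<^sup>2) ^ (n - k)))"
    unfolding phi43_terminating [OF term_one] sum_distrib_left
    by (intro sum.cong refl phi43_term) (use assms(1-3) c nz in auto)
  also have "(\<Sum>k\<le>n. ?A k * ?A (n - k) * q ^ k * (1 - c * (q\<^sup>2) ^ (n - k)))
      = moment ?A q 1 0 n - c * moment ?A q 1 2 n"
    unfolding moment_def sum_distrib_left sum_subtractf [symmetric]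
    by (intro sum.cong refl) (simp add: algebra_simps flip: power_mult)
  also have "moment ?A q 1 2 n = q ^ n * moment ?A q 1 0 n"
    using moment_commute [of ?A q 0 1 n] by (simp add: numeral_eq_Suc moment_Suc_Suc)
  finally have lhs: "phi43 (q powi (- 2 * int n)) a b (q powi (3 - 2 * int n) / (a * b))
               (q powi (2 - 2 * int n) / a) (q powi (2 - 2 * int n) / b) (a * b * q) (q\<^sup>2) (q\<^sup>2)
      = ?K * ((1 - c * q ^ n) * moment ?A q 1 0 n)"
    by (simp add: algebra_simps)
  have sq: "qpoch (q\<^sup>2) (q\<^sup>2) n = qpoch q q n * qpoch (- q) q n" by (rule qpoch_square)
  have T: "qpoch q q n * (?I * (1 - c * q ^ n)) * qpoch (a * b * q) (q\<^sup>2) n * moment ?A q 1 0 n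
         = qpoch a q n * qpoch b q n * qpoch (a * b) (q\<^sup>2) n"
    unfolding I by (rule moment_phi21 [OF nz(1,2) c])
  have "?K * ((1 - c * q ^ n) * moment ?A q 1 0 n)
      = qpoch (- q) q n * (qpoch q q n * (?I * (1 - c * q ^ n)) * qpoch (a * b * q) (q\<^sup>2) n
          * moment ?A q 1 0 n) / (?D * ?I * (qpoch a (q\<^sup>2) n * qpoch b (q\<^sup>2) n))"
    unfolding sq using nz assms(6) by (simp add: divide_simps)
  then show ?thesis
    unfolding lhs T D by (simp add: qpochs_def mult_ac)
qed

end
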